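(* Let $M,C,N,O$ be nonnegative integers with $C$, $O$ and $M$ of the same parity, $C\le M$, and $O>C$. Let $k$ be a positive integer such that $$k(O-C)+1-\binom{O-C+1}{2}>\frac{M+C}{2}+N+O.$$ Then $k\in\mathcal{A}_{M+1,C+1,N+1,O-1}$ implies $k\in\mathcal{A}_{M,C,N,O}$.
   Context: $\mathcal{Q}_n$ is the $n$-dimensional binary hypercube: its vertices are all binary sequences of length $n$, adjacent iff they differ in exactly one position. A vertex is even or odd according to the parity of its number of 1's; vertices of one parity are called red and those of the other parity green. A path covering of a graph is a set of vertex-disjoint paths that cover all vertices of the graph. A fault $\mathcal{F}$ in $\mathcal{Q}_n$ is a set of deleted vertices; its mass is $|\mathcal{F}|$ and its charge is $|r(\mathcal{F})-g(\mathcal{F})|$, where $r(\mathcal{F})$, $g(\mathcal{F})$ are the numbers of red and green vertices in $\mathcal{F}$. $\mathcal{Q}_n-\mathcal{F}$ is the subgraph induced by the non-deleted vertices. A pair of vertices (or a path, via its two endpoints) is neutral if the two vertices have opposite parity and charged if they have the same parity; a charged pair is red (green) if its elements are red (green). A set $\mathcal{E}$ of disjoint pairs of vertices is in balance with $\mathcal{F}$ if all vertices in the pairs lie in $\mathcal{Q}_n-\mathcal{F}$ and $r(\mathcal{F})-g(\mathcal{F})=g(\mathcal{E})-r(\mathcal{E})$, where $r(\mathcal{E})$, $g(\mathcal{E})$ are the numbers of red and green pairs in $\mathcal{E}$. For a fault $\mathcal{F}$ of mass $M$ and charge $C$ in $\mathcal{Q}_n$, one can freely prescribe ends for a path covering of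 $\mathcal{Q}_n-\mathcal{F}$ with $N$ neutral paths and $O$ charged paths if (i) there is at least one set $\mathcal{E}$ of disjoint pairs of vertices in balance with $\mathcal{F}$ containing exactly $N$ neutral and $O$ charged pairs, and (ii) for every such $\mathcal{E}$ there is a path covering of $\mathcal{Q}_n-\mathcal{F}$ whose set of pairs of end vertices is $\mathcal{E}$. For nonnegative integers $M,C,N,O$, $\mathcal{A}_{M,C,N,O}$ is the set of nonnegative integers $m$ such that $m\ge\log_2[M+C+2N+2O]$ and for every $n\ge m$ and every fault $\mathcal{F}$ of mass $M$ and charge $C$ in $\mathcal{Q}_n$ one can freely prescribe ends for a path covering of $\mathcal{Q}_n-\mathcal{F}$ with $N$ neutral and $O$ charged paths. *)

theory Defs
  imports Complex_Main "HOL-Library.Disjoint_Sets"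
begin

definition is_path :: "'a set \<Rightarrow> ('a \<Rightarrow> 'a \<Rightarrow> bool) \<Rightarrow> 'a list \<Rightarrow> bool" where
  "is_path V adj p \<longleftrightarrow> p \<noteq> [] \<and> set p \<subseteq> V \<and> distinct p \<and> successively adj p"

text \<open>
  A path is represented by either of its two orientations. Distinct members of a covering
  are vertex-disjoint, so a covering never contains both orientations of the same path.
\<close>

definition path_covering :: "'a set \<Rightarrow> ('a \<Rightarrow> 'a \<Rightarrow> bool) \<Rightarrow> 'a list set \<Rightarrow> bool" where
  "path_covering V adj \<P> \<longleftrightarrow>
     (\<forall>p\<in>\<P>. is_path V adj p) \<and>
     (\<forall>p\<in>\<P>. \<forall>q\<in>\<P>. p \<noteq> q \<longrightarrow> set p \<inter> set q = {}) \<and>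
     (\<Union>p\<in>\<P>. set p) = V"

definition path_ends :: "'a list \<Rightarrow> 'a set" where
  "path_ends p = {hd p, last p}"

definition cube :: "nat \<Rightarrow> bool list set" where
  "cube n = {x. length x = n}"

definition cube_adj :: "bool list \<Rightarrow> bool list \<Rightarrow> bool" where
  "cube_adj x y \<longleftrightarrow> length x = length y \<and> card {i. i < length x \<and> x ! i \<noteq> y ! i} = 1"

text \<open>
  Which parity class is called red is immaterial, since the notions below are
  invariant under exchanging the two colours.
\<close>

definition red :: "bool list \<Rightarrow> bool" where
  "red x \<longleftrightarrow> even (count_list x True)"

definition green :: "bool list \<Rightarrow> bool" where
  "green x \<longleftrightarrow> odd (count_list x True)"

definition fault :: "nat \<Rightarrow> bool list set \<Rightarrow> bool" where
  "fault n F \<longleftrightarrow> F \<subseteq> cube n"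

definition mass :: "bool list set \<Rightarrow> nat" where
  "mass F = card F"

definition signed_charge :: "bool list set \<Rightarrow> int" where
  "signed_charge F = int (card {x \<in> F. red x}) - int (card {x \<in> F. green x})"

definition charge :: "bool list set \<Rightarrow> nat" where
  "charge F = nat \<bar>signed_charge F\<bar>"

text \<open>
  A pair is an unordered pair of two different vertices, i.e. a two-element set.
\<close>

definition neutral_pair :: "bool list set \<Rightarrow> bool" where
  "neutral_pair e \<longleftrightarrow> (\<exists>u v. e = {u, v} \<and> red u \<and> green v)"

definition red_pair :: "bool list set \<Rightarrow> bool" where
  "red_pair e \<longleftrightarrow> (\<exists>u v. e = {u, v} \<and> u \<noteq> v \<and> red u \<and> red v)"

definition green_pair :: "bool list set \<Rightarrow> bool" where
  "green_pair e \<longleftrightarrow> (\<exists>u v. e = {u, v} \<and> u \<noteq> v \<and> green u \<and> green v)"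

definition charged_pair :: "bool list set \<Rightarrow> bool" where
  "charged_pair e \<longleftrightarrow> red_pair e \<or> green_pair e"

definition disjoint_pairs :: "bool list set set \<Rightarrow> bool" where
  "disjoint_pairs E \<longleftrightarrow> (\<forall>e\<in>E. card e = 2) \<and> disjoint E"

definition in_balance :: "nat \<Rightarrow> bool list set \<Rightarrow> bool list set set \<Rightarrow> bool" where
  "in_balance n F E \<longleftrightarrow>
     \<Union>E \<subseteq> cube n - F \<and>
     signed_charge F = int (card {e \<in> E. green_pair e}) - int (card {e \<in> E. red_pair e})"

definition admissible_ends ::
    "nat \<Rightarrow> bool list set \<Rightarrow> nat \<Rightarrow> nat \<Rightarrow> bool list set set \<Rightarrow> bool" where
  "admissible_ends n F N P E \<longleftrightarrow>
     disjoint_pairs E \<and> in_balance n F E \<and>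
     card {e \<in> E. neutral_pair e} = N \<and> card {e \<in> E. charged_pair e} = P"

definition freely_prescribable :: "nat \<Rightarrow> bool list set \<Rightarrow> nat \<Rightarrow> nat \<Rightarrow> bool" where
  "freely_prescribable n F N P \<longleftrightarrow>
     (\<exists>E. admissible_ends n F N P E) \<and>
     (\<forall>E. admissible_ends n F N P E \<longrightarrow>
        (\<exists>\<P>. path_covering (cube n - F) cube_adj \<P> \<and> path_ends ` \<P> = E))"

definition \<A> :: "nat \<Rightarrow> nat \<Rightarrow> nat \<Rightarrow> nat \<Rightarrow> nat set" where
  "\<A> M C N P =
     {m. real m \<ge> log 2 (real (M + C + 2 * N + 2 * P)) \<and>
         (\<forall>n\<ge>m. \<forall>F. fault n F \<and> mass F = M \<and> charge F = C \<longrightarrow>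
            freely_prescribable n F N P)}"

end

theory Submission
  imports Defs
begin

text \<open>
  Suppose that the fault \<open>F\<close> contains \<open>C\<close> more vertices of one colour, say red, than of the
  other. An admissible set of pairs then has \<open>C\<close> more green pairs than red pairs, so that
  \<open>P > C\<close> leaves \<open>(P - C) / 2 > 0\<close> red pairs, with \<open>P - C\<close> ends in total.

  Let \<open>a\<close> be one of these ends, \<open>{a, d}\<close> its pair, and \<open>c\<close> a neighbour of \<open>a\<close>
  that is neither deleted nor an end. Deleting \<open>a\<close> and prescribing the neutral pair
  \<open>{c, d}\<close> in place of the red pair \<open>{a, d}\<close> gives a problem with parameters
  \<open>M + 1, C + 1, N + 1, P - 1\<close>, and a solution of it becomes a solution of the original
  problem when the path ending at \<open>c\<close> is prolonged by the edge to \<open>a\<close>.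

  Such \<open>a\<close> and \<open>c\<close> exist by counting. Neighbours of red vertices are green, and only
  \<open>(M - C) / 2\<close> green vertices are deleted and \<open>N + P + C\<close> are ends, which is
  \<open>(M + C) / 2 + N + P\<close> together. On the other hand \<open>s > 0\<close> vertices of the \<open>n\<close>-cube have
  at least \<open>n s + 1 - (s + 1 choose 2)\<close> neighbours altogether (\<open>card_neighbours_ge\<close>).
  The numerical hypothesis says precisely that the second number, for \<open>s = P - C\<close>
  and \<open>n = k\<close>, exceeds the first, and the second only grows with \<open>n\<close>.

  That some admissible set of pairs exists at all follows from the same exchange read
  backwards: a red vertex \<open>a\<close> outside \<open>F\<close> is deleted, and in an admissible set for the
  enlarged fault the green end of a neutral pair is replaced by \<open>a\<close>.
\<close>

section \<open>Colours, uniformly in the majority colour\<close>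

text \<open>
  The colour is a parameter, with \<open>col True\<close> red and \<open>col False\<close> green, so that the two
  signs of the charge are one case.
\<close>

definition col :: "bool \<Rightarrow> bool list \<Rightarrow> bool" where
  "col b x \<longleftrightarrow> (even (count_list x True) \<longleftrightarrow> b)"

definition excess :: "bool \<Rightarrow> bool list set \<Rightarrow> int" where
  "excess b F = int (card {x \<in> F. col b x}) - int (card {x \<in> F. col (\<not> b) x})"

definition mono_pair :: "bool \<Rightarrow> bool list set \<Rightarrow> bool" where
  "mono_pair b e \<longleftrightarrow> (\<exists>u v. e = {u, v} \<and> u \<noteq> v \<and> col b u \<and> col b v)"

lemma col_Not [simp]: "col (\<not> b) x \<longleftrightarrow> \<not> col b x"
  by (auto simp: col_def)

lemma red_eq_col: "red = col True" and green_eq_col: "green = col False"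
  by (auto simp: fun_eq_iff red_def green_def col_def)

lemma red_pair_eq_mono_pair: "red_pair = mono_pair True"
  and green_pair_eq_mono_pair: "green_pair = mono_pair False"
  by (auto simp: fun_eq_iff red_pair_def green_pair_def mono_pair_def red_eq_col green_eq_col)

lemma mono_pair_doubleton: "mono_pair b {u, v} \<longleftrightarrow> u \<noteq> v \<and> col b u \<and> col b v"
  by (auto simp: mono_pair_def doubleton_eq_iff)

lemma neutral_pair_doubleton: "neutral_pair {u, v} \<longleftrightarrow> (col b u \<longleftrightarrow> \<not> col b v)"
  by (cases b) (auto simp: neutral_pair_def doubleton_eq_iff red_def green_def col_def)

lemma mono_pair_disjoint: "mono_pair b e \<Longrightarrow> \<not> mono_pair (\<not> b) e"
  by (auto simp: mono_pair_def doubleton_eq_iff)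

lemma signed_charge_eq_excess: "signed_charge F = (if b then excess b F else - excess b F)"
  by (cases b) (simp_all add: signed_charge_def excess_def red_eq_col green_eq_col)

lemma charge_eq_imp_excess:
  assumes "charge F = C"
  obtains b where "excess b F = int C"
proof -
  have "excess True F = int C \<or> excess False F = int C"
    using assms signed_charge_eq_excess[of F True] signed_charge_eq_excess[of F False]
    by (auto simp: charge_def)
  then show thesis using that by blast
qed

lemma excess_imp_charge: "excess b F = int C \<Longrightarrow> charge F = C"
  using signed_charge_eq_excess[of F b] by (simp add: charge_def split: if_splits)

lemma card_eq_sum_col:
  "finite F \<Longrightarrow> card F = card {x \<in> F. col b x} + card {x \<in> F. col (\<not> b) x}"
  by (subst card_Un_disjoint[symmetric]) (auto intro: arg_cong[of _ _ card])

lemma excess_insert: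
  assumes "finite F" "a \<notin> F" "col b a"
  shows "excess b (insert a F) = excess b F + 1"
proof -
  have "{x \<in> insert a F. col b x} = insert a {x \<in> F. col b x}"
    and "{x \<in> insert a F. col (\<not> b) x} = {x \<in> F. col (\<not> b) x}"
    using assms by auto
  then show ?thesis
    using assms by (simp add: excess_def)
qed

lemma finite_cube: "finite (cube n)"
  using finite_lists_length_eq[of "UNIV :: bool set" n] by (simp add: cube_def)

lemma card_cube: "card (cube n) = 2 ^ n"
  using card_lists_length_eq[of "UNIV :: bool set" n] by (simp add: cube_def)

lemma admissible_ends_iff:
  "admissible_ends n F N P E \<longleftrightarrow>
     disjoint_pairs E \<and> \<Union>E \<subseteq> cube n - F \<and>
     excess b F = int (card {e \<in> E. mono_pair (\<not> b) e}) - int (card {e \<in> E. mono_pair b e}) \<and>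
     card {e \<in> E. neutral_pair e} = N \<and>
     card {e \<in> E. mono_pair b e} + card {e \<in> E. mono_pair (\<not> b) e} = P"
proof (cases "\<Union>E \<subseteq> cube n - F")
  case True
  then have "finite E"
    by (meson finite_Diff finite_UnionD finite_cube finite_subset)
  have "{e \<in> E. charged_pair e} = {e \<in> E. mono_pair b e} \<union> {e \<in> E. mono_pair (\<not> b) e}"
    by (cases b)
      (auto simp: charged_pair_def red_pair_eq_mono_pair green_pair_eq_mono_pair)
  moreover have "{e \<in> E. mono_pair b e} \<inter> {e \<in> E. mono_pair (\<not> b) e} = {}"
    using mono_pair_disjoint by blast
  ultimately have "card {e \<in> E. charged_pair e} =
      card {e \<in> E. mono_pair b e} + card {e \<in> E. mono_pair (\<not> b) e}"
    using \<open>finite E\<close> by (simp add: card_Un_disjoint)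
  then show ?thesis
    unfolding admissible_ends_def in_balance_def red_pair_eq_mono_pair green_pair_eq_mono_pair
    using signed_charge_eq_excess[of F b] by (cases b) auto
next
  case False
  then show ?thesis
    unfolding admissible_ends_def in_balance_def by simp
qed

section \<open>Neighbourhoods in the hypercube\<close>

definition flip :: "nat \<Rightarrow> bool list \<Rightarrow> bool list" where
  "flip i x = x[i := \<not> x ! i]"

definition neighbours :: "nat set \<Rightarrow> bool list set \<Rightarrow> bool list set" where
  "neighbours D S = (\<Union>i\<in>D. flip i ` S)"

lemma length_flip [simp]: "length (flip i x) = length x"
  by (simp add: flip_def)

lemma flip_flip: "flip i (flip i x) = x"
  by (cases "i < length x") (simp_all add: flip_def list_update_beyond)

lemma nth_flip: "i < length x \<Longrightarrow> flip i x ! j = (if i = j then \<not> x ! j else x ! j)"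
  by (simp add: flip_def nth_list_update)

lemma cube_adj_flip:
  assumes "i < length x"
  shows "cube_adj x (flip i x)"
proof -
  have "{j. j < length x \<and> x ! j \<noteq> flip i x ! j} = {i}"
    using assms by (auto simp: nth_flip)
  then show ?thesis
    by (simp add: cube_adj_def)
qed

lemma cube_adj_commute: "cube_adj x y \<longleftrightarrow> cube_adj y x"
proof -
  have "length x = length y \<Longrightarrow> {i. i < length x \<and> x ! i \<noteq> y ! i} = {i. i < length y \<and> y ! i \<noteq> x ! i}"
    by auto
  then show ?thesis
    unfolding cube_adj_def by metis
qed

lemma col_flip:
  assumes "i < length x"
  shows "col b (flip i x) \<longleftrightarrow> \<not> col b x"
proof -
  let ?rest = "count_list (take i x) True + count_list (drop (Suc i) x) True"
  have "count_list (flip i x) True = ?rest + of_bool (\<not> x ! i)"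
    using assms by (simp add: flip_def upd_conv_take_nth_drop)
  moreover have "count_list x True = ?rest + of_bool (x ! i)"
    using arg_cong[OF id_take_nth_drop[OF assms], of "\<lambda>y. count_list y True"] by simp
  ultimately have "even (count_list (flip i x) True) \<longleftrightarrow> odd (count_list x True)"
    by simp
  then show ?thesis
    by (auto simp: col_def)
qed

lemma choose_two_add:
  "(a + b + 1) choose 2 = ((a + 1) choose 2) + ((b + 1) choose 2) + a * b"
  by (induction a) (simp_all add: numeral_2_eq_2)

text \<open>
  The bound is attained, with all directions allowed, by \<open>s \<le> n\<close> neighbours of a single
  vertex. The induction splits \<open>S\<close>
  by a coordinate \<open>i\<close> in which two of its elements differ, into nonempty parts of sizes
  \<open>s\<^sub>0\<close> and \<open>s\<^sub>1\<close>. Flips in the other coordinates preserve the \<open>i\<close>-th one, so the parts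
  have disjoint sets of neighbours in these directions. Not counting direction \<open>i\<close> loses at
  most \<open>s\<^sub>0 + s\<^sub>1\<close>, which the term \<open>s\<^sub>0 s\<^sub>1\<close> by which the binomial coefficients differ
  and the extra summand \<open>1\<close> make up for, since \<open>(s\<^sub>0 - 1) (s\<^sub>1 - 1) \<ge> 0\<close>. The set of
  directions is a parameter so that dropping a coordinate does not change the cube.
\<close>

lemma card_neighbours_ge:
  assumes "S \<noteq> {}" "S \<subseteq> cube n" "D \<subseteq> {..<n}"
  shows "card D * card S + 1 \<le> card (neighbours D S) + ((card S + 1) choose 2)"
  using assms
proof (induction "card S" arbitrary: S D rule: less_induct)
  case less
  have fin: "finite S" "finite D"
    using less.prems finite_subset[OF _ finite_cube] finite_subset[OF _ finite_lessThan] by blast+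
  show ?case
  proof (cases "\<exists>x\<in>S. \<exists>y\<in>S. x \<noteq> y")
    case False
    with less.prems obtain x where S: "S = {x}"
      by blast
    then have len: "length x = n"
      using less.prems by (simp add: cube_def)
    have "inj_on (\<lambda>i. flip i x) D"
    proof (rule inj_onI)
      fix i j assume "i \<in> D" "j \<in> D" and eq: "flip i x = flip j x"
      then have "i < length x" "j < length x"
        using less.prems len by auto
      then show "i = j"
        using arg_cong[OF eq, of "\<lambda>y. y ! i"] by (auto simp: nth_flip split: if_splits)
    qed
    moreover have "neighbours D S = (\<lambda>i. flip i x) ` D"
      by (auto simp: neighbours_def S)
    ultimately show ?thesis
      by (simp add: S card_image numeral_2_eq_2)
  next
    case True
    then obtain x y where xy: "x \<in> S" "y \<in> S" "x \<noteq> y"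
      by blast
    moreover have len: "length z = n" if "z \<in> S" for z
      using that less.prems by (auto simp: cube_def)
    ultimately obtain i where i: "i < n" "x ! i \<noteq> y ! i"
      using nth_equalityI[of x y] by metis
    define part where "part b = {z \<in> S. z ! i = b}" for b
    define D' where "D' = D - {i}"
    have part: "part b \<noteq> {}" "part b \<subseteq> S" "finite (part b)" for b
      using xy i fin by (cases b; auto simp: part_def)+
    have S_eq: "S = part True \<union> part False" and disj: "part True \<inter> part False = {}"
      by (auto simp: part_def)
    have card_S: "card S = card (part True) + card (part False)"
      unfolding S_eq using disj part by (rule_tac card_Un_disjoint) auto
    have pos: "card (part b) > 0" for b
      using part[of b] by (simp add: card_gt_0_iff)
    have IH: "card D' * card (part b) + 1
        \<le> card (neighbours D' (part b)) + ((card (part b) + 1) choose 2)" for b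
    proof (rule less.hyps)
      show "card (part b) < card S"
        using card_S pos by (cases b) auto
    qed (use part[of b] less.prems in \<open>auto simp: D'_def\<close>)
    have coord: "z ! i = b" if z: "z \<in> neighbours D' (part b)" for z b
    proof -
      obtain j w where jw: "z = flip j w" "j \<in> D" "j \<noteq> i" "w \<in> S" "w ! i = b"
        using z by (auto simp: neighbours_def D'_def part_def)
      then show ?thesis
        using less.prems len[of w] by (auto simp: nth_flip)
    qed
    have fin_nb: "finite (neighbours D'' T)" if "finite D''" "finite T" for D'' T
      using that by (simp add: neighbours_def)
    have "card (neighbours D' (part True)) + card (neighbours D' (part False))
        = card (neighbours D' (part True) \<union> neighbours D' (part False))"
      using coord[of _ True] coord[of _ False] part fin
      by (intro card_Un_disjoint[symmetric] fin_nb) (auto simp: D'_def)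
    also have "\<dots> \<le> card (neighbours D S)"
      using part(2) fin by (intro card_mono fin_nb) (fastforce simp: neighbours_def D'_def)+
    finally have nb: "card (neighbours D' (part True)) + card (neighbours D' (part False))
        \<le> card (neighbours D S)" .
    have "card D \<le> card D' + 1"
      using fin card_Diff_singleton_if[of D i] by (auto simp: D'_def)
    then have "card D * card S \<le> (card D' + 1) * card S"
      by (rule mult_le_mono1)
    moreover obtain s t where "card (part True) = Suc s" "card (part False) = Suc t"
      using pos[of True] pos[of False] gr0_conv_Suc by auto
    ultimately show ?thesis
      using IH[of True] IH[of False] nb
        choose_two_add[of "card (part True)" "card (part False)"]
      unfolding card_S by (simp add: algebra_simps)
  qed
qed

section \<open>Exchanging an end for a neighbour\<close>

lemma disjoint_pairs_exchange:
  assumes E: "disjoint_pairs E" and ad: "{a, d} \<in> E" and c: "c \<notin> \<Union>E"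
  defines "E' \<equiv> insert {c, d} (E - {{a, d}})"
  shows "disjoint_pairs E'" and "\<Union>E' = insert c (\<Union>E - {a})"
proof -
  have "a \<noteq> d"
    using E ad unfolding disjoint_pairs_def by (metis card_2_iff doubleton_eq_iff insert_absorb2)
  have other: "e \<inter> {a, d} = {}" if "e \<in> E" "e \<noteq> {a, d}" for e
    using E ad that unfolding disjoint_pairs_def by (meson disjointD)
  have "c \<noteq> d" "c \<noteq> a"
    using ad c by auto
  show "disjoint_pairs E'"
    unfolding disjoint_pairs_def
  proof
    show "\<forall>e\<in>E'. card e = 2"
      using E \<open>c \<noteq> d\<close> by (auto simp: E'_def disjoint_pairs_def)
    show "disjoint E'"
      unfolding E'_def
      unfolding pairwise_insert
    proof (intro conjI)
      show "disjoint (E - {{a, d}})"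
        using E unfolding disjoint_pairs_def by (meson Diff_subset pairwise_subset)
    qed (use other c in \<open>auto simp: disjnt_def\<close>)
  qed
  show "\<Union>E' = insert c (\<Union>E - {a})"
  proof -
    have "\<Union>(E - {{a, d}}) = \<Union>E - {a, d}"
      using other ad by auto
    then show ?thesis
      using ad \<open>a \<noteq> d\<close> \<open>c \<noteq> d\<close> by (auto simp: E'_def)
  qed
qed

lemma card_filter_exchange:
  assumes "finite E" "e \<in> E" "e' \<notin> E"
  shows "int (card {x \<in> insert e' (E - {e}). Q x}) =
    int (card {x \<in> E. Q x}) - of_bool (Q e) + of_bool (Q e')"
proof -
  have "{x \<in> insert e' (E - {e}). Q x} =
      (if Q e' then insert e' ({x \<in> E. Q x} - {e}) else {x \<in> E. Q x} - {e})"
    by auto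
  moreover have "card {x \<in> E. Q x} > 0" if "Q e"
    using assms that by (auto simp: card_gt_0_iff)
  ultimately show ?thesis
    using assms by (auto simp: card_Diff_singleton_if)
qed

text \<open>
  Turning a pair of colour \<open>b\<close> into a neutral one raises by one the surplus of pairs of
  the other colour; deleting \<open>a\<close>, of colour \<open>b\<close>, raises the excess of the fault by
  one. So the balance is kept, and likewise when the step is undone.
\<close>

lemma admissible_ends_exchange:
  assumes adm: "admissible_ends n F N P E" and ad: "{a, d} \<in> E"
    and col: "col b a" "col b d" "\<not> col b c"
    and c: "c \<in> cube n - F - \<Union>E" and F: "F \<subseteq> cube n"
  shows "admissible_ends n (insert a F) (N + 1) (P - 1) (insert {c, d} (E - {{a, d}}))"
proof -
  note E = adm[unfolded admissible_ends_iff[of n F N P E b]]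
  have fin: "finite E" "finite F"
    using E F by (meson finite_Diff finite_UnionD finite_cube finite_subset)+
  have "{c, d} \<notin> E" "a \<notin> F" "a \<noteq> d" "a \<noteq> c" "c \<noteq> d"
    using c ad E col by (auto simp: disjoint_pairs_def)
  note ex = excess_insert[OF fin(2) \<open>a \<notin> F\<close> col(1)]
  define E' where "E' = insert {c, d} (E - {{a, d}})"
  have cnt: "int (card {e \<in> E'. Q e}) =
      int (card {e \<in> E. Q e}) - of_bool (Q {a, d}) + of_bool (Q {c, d})" for Q
    unfolding E'_def by (rule card_filter_exchange[OF fin(1) ad \<open>{c, d} \<notin> E\<close>])
  have neutral: "int (card {e \<in> E'. neutral_pair e}) = int (card {e \<in> E. neutral_pair e}) + 1"
    using cnt[of neutral_pair] col by (simp add: neutral_pair_doubleton[of _ _ b])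
  have major: "int (card {e \<in> E'. mono_pair b e}) = int (card {e \<in> E. mono_pair b e}) - 1"
    using cnt[of "mono_pair b"] col \<open>a \<noteq> d\<close> by (simp add: mono_pair_doubleton)
  have minor: "card {e \<in> E'. mono_pair (\<not> b) e} = card {e \<in> E. mono_pair (\<not> b) e}"
    using cnt[of "mono_pair (\<not> b)"] col by (simp add: mono_pair_doubleton)
  have "c \<notin> \<Union>E" "disjoint_pairs E"
    using c E by auto
  note dp = disjoint_pairs_exchange[OF this(2) ad this(1), folded E'_def]
  have "\<Union>E' \<subseteq> cube n - insert a F"
    using E c \<open>a \<noteq> c\<close> unfolding dp(2) by blast
  moreover have "excess b (insert a F) =
      int (card {e \<in> E'. mono_pair (\<not> b) e}) - int (card {e \<in> E'. mono_pair b e})"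
    using ex E minor major by linarith
  moreover have "card {e \<in> E'. mono_pair b e} + card {e \<in> E'. mono_pair (\<not> b) e} = P - 1"
    using E minor major by linarith
  moreover have "card {e \<in> E'. neutral_pair e} = N + 1"
    using E neutral by linarith
  ultimately show ?thesis
    unfolding E'_def[symmetric] admissible_ends_iff[of _ _ _ _ E' b] using dp(1) by blast
qed

lemma admissible_ends_exchange_back:
  assumes adm: "admissible_ends n (insert a F) (N + 1) (P - 1) E" and cd: "{c, d} \<in> E"
    and col: "col b a" "col b d" "\<not> col b c"
    and a: "a \<in> cube n - F" and F: "F \<subseteq> cube n" and P: "P > 0"
  shows "admissible_ends n F N P (insert {a, d} (E - {{c, d}}))"
proof -
  note E = adm[unfolded admissible_ends_iff[of n "insert a F" "N + 1" "P - 1" E b]]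
  have fin: "finite E" "finite F"
    using E F by (meson finite_Diff finite_UnionD finite_cube finite_subset)+
  have "a \<notin> \<Union>E" "disjoint_pairs E"
    using E by auto
  note dp = disjoint_pairs_exchange[OF this(2) cd this(1)]
  have "{a, d} \<notin> E" "a \<noteq> d" "a \<notin> F"
    using cd a \<open>a \<notin> \<Union>E\<close> by auto
  note ex = excess_insert[OF fin(2) \<open>a \<notin> F\<close> col(1)]
  define E' where "E' = insert {a, d} (E - {{c, d}})"
  have cnt: "int (card {e \<in> E'. Q e}) =
      int (card {e \<in> E. Q e}) - of_bool (Q {c, d}) + of_bool (Q {a, d})" for Q
    unfolding E'_def by (rule card_filter_exchange[OF fin(1) cd \<open>{a, d} \<notin> E\<close>])
  have neutral: "int (card {e \<in> E'. neutral_pair e}) = int (card {e \<in> E. neutral_pair e}) - 1"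
    using cnt[of neutral_pair] col by (simp add: neutral_pair_doubleton[of _ _ b])
  have major: "int (card {e \<in> E'. mono_pair b e}) = int (card {e \<in> E. mono_pair b e}) + 1"
    using cnt[of "mono_pair b"] col \<open>a \<noteq> d\<close> by (simp add: mono_pair_doubleton)
  have minor: "card {e \<in> E'. mono_pair (\<not> b) e} = card {e \<in> E. mono_pair (\<not> b) e}"
    using cnt[of "mono_pair (\<not> b)"] col by (simp add: mono_pair_doubleton)
  have "\<Union>E' \<subseteq> cube n - F"
    using E a unfolding dp(2)[folded E'_def] by blast
  moreover have "excess b F =
      int (card {e \<in> E'. mono_pair (\<not> b) e}) - int (card {e \<in> E'. mono_pair b e})"
    using ex E minor major by linarith
  moreover have "card {e \<in> E'. mono_pair b e} + card {e \<in> E'. mono_pair (\<not> b) e} = P"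
    using E minor major P by linarith
  moreover have "card {e \<in> E'. neutral_pair e} = N"
    using E neutral by linarith
  ultimately show ?thesis
    unfolding E'_def[symmetric] admissible_ends_iff[of _ _ _ _ E' b]
    using dp(1)[folded E'_def] by blast
qed

lemma is_path_extend:
  assumes p: "is_path (V - {a}) adj p" and ends: "path_ends p = {c, d}"
    and a: "a \<in> V" and adj: "adj a c" "adj c a"
  obtains q where "is_path V adj q" "set q = insert a (set p)" "path_ends q = {a, d}"
proof (cases "hd p = c \<and> last p = d")
  case True
  then have "is_path V adj (a # p)" "path_ends (a # p) = {a, d}"
    using p a adj by (auto simp: is_path_def path_ends_def successively_Cons)
  then show thesis
    by (intro that[of "a # p"]) auto
next
  case False
  then have "hd p = d" "last p = c"
    using ends by (auto simp: path_ends_def doubleton_eq_iff)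
  then have "is_path V adj (p @ [a])" "path_ends (p @ [a]) = {a, d}"
    using p a adj by (auto simp: is_path_def path_ends_def successively_append_iff)
  then show thesis
    by (intro that[of "p @ [a]"]) auto
qed

lemma path_covering_extend:
  assumes cov: "path_covering (V - {a}) adj \<P>" and cd: "{c, d} \<in> path_ends ` \<P>"
    and a: "a \<in> V" and adj: "adj a c" "adj c a"
  obtains \<Q> where "path_covering V adj \<Q>"
    and "path_ends ` \<Q> = insert {a, d} (path_ends ` \<P> - {{c, d}})"
proof -
  obtain p where p: "p \<in> \<P>" "path_ends p = {c, d}"
    using cd by auto
  have path: "is_path (V - {a}) adj r" if "r \<in> \<P>" for r
    using cov that by (auto simp: path_covering_def)
  have disj: "set r \<inter> set s = {}" if "r \<in> \<P>" "s \<in> \<P>" "r \<noteq> s" for r s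
    using cov that by (auto simp: path_covering_def)
  have Un: "(\<Union>r\<in>\<P>. set r) = V - {a}"
    using cov by (simp add: path_covering_def)
  obtain q where q: "is_path V adj q" "set q = insert a (set p)" "path_ends q = {a, d}"
    using is_path_extend[OF path[OF p(1)] p(2) a adj] .
  have ends_in: "path_ends r \<subseteq> set r" "path_ends r \<noteq> {}" if "r \<in> \<P>" for r
    using path[OF that] by (auto simp: is_path_def path_ends_def)
  \<comment> \<open>Vertex-disjoint paths have different ends, so \<open>p\<close> alone has the ends \<open>{c, d}\<close>.\<close>
  have ends_ne: "path_ends r \<noteq> {c, d}" if "r \<in> \<P>" "r \<noteq> p" for r
    using ends_in[OF that(1)] ends_in[OF p(1)] disj[OF that(1) p(1) that(2)] p(2) by auto
  have not_a: "a \<notin> set r" if "r \<in> \<P>" for r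
    using Un that by auto
  show thesis
  proof (rule that[of "insert q (\<P> - {p})"])
    show "path_covering V adj (insert q (\<P> - {p}))"
      unfolding path_covering_def
    proof (intro conjI)
      show "\<forall>r\<in>insert q (\<P> - {p}). is_path V adj r"
        using q(1) path by (auto simp: is_path_def)
      have "set q \<inter> set r = {}" if "r \<in> \<P> - {p}" for r
        using disj[OF p(1), of r] not_a[of r] q(2) that by auto
      then show "\<forall>r\<in>insert q (\<P> - {p}). \<forall>s\<in>insert q (\<P> - {p}). r \<noteq> s \<longrightarrow> set r \<inter> set s = {}"
        using disj by (auto simp: Int_commute)
      have "(\<Union>r\<in>insert q (\<P> - {p}). set r) = insert a (\<Union>r\<in>\<P>. set r)"
        using q(2) p(1) by auto
      then show "(\<Union>r\<in>insert q (\<P> - {p}). set r) = V"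
        using Un a by auto
    qed
    show "path_ends ` insert q (\<P> - {p}) = insert {a, d} (path_ends ` \<P> - {{c, d}})"
      using q(3) p ends_ne by auto
  qed
qed

section \<open>Counting\<close>

text \<open>
  The cube has as many vertices of either colour, since \<open>flip 0\<close> exchanges the colours, and
  \<open>F\<close> contains only \<open>(card F + C) / 2\<close> vertices of colour \<open>b\<close>.
\<close>

lemma free_vertex_exists:
  assumes F: "F \<subseteq> cube n" and ex: "excess b F = int C" and n: "n > 0"
    and less: "card F + C < 2 ^ n"
  obtains a where "a \<in> cube n - F" "col b a"
proof (rule ccontr)
  assume "\<not> thesis"
  then have sub: "{x \<in> cube n. col b x} \<subseteq> {x \<in> F. col b x}"
    using that by auto
  have fin: "finite F"
    using F finite_cube finite_subset by blast
  have "flip 0 ` {x \<in> cube n. col (\<not> b) x} \<subseteq> {x \<in> cube n. col b x}"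
    using n by (auto simp: cube_def col_flip)
  moreover have "inj_on (flip 0) {x \<in> cube n. col (\<not> b) x}"
    by (rule inj_on_inverseI[of _ "flip 0"]) (rule flip_flip)
  ultimately have "card {x \<in> cube n. col (\<not> b) x} \<le> card {x \<in> cube n. col b x}"
    using finite_cube by (intro card_inj_on_le) auto
  moreover have "card {x \<in> cube n. col b x} \<le> card {x \<in> F. col b x}"
    using sub fin by (intro card_mono) auto
  ultimately have "2 ^ n \<le> 2 * card {x \<in> F. col b x}"
    using card_eq_sum_col[OF finite_cube, of n b] by (simp add: card_cube)
  also have "\<dots> = card F + C"
    using card_eq_sum_col[OF fin, of b] ex by (simp add: excess_def)
  finally show False
    using less by simp
qed

lemma card_Union_mono_pairs:
  assumes "disjoint_pairs E"
  shows "card (\<Union>{e \<in> E. mono_pair b e}) = 2 * card {e \<in> E. mono_pair b e}"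
proof -
  have two: "card e = 2" if "e \<in> E" for e
    using assms that by (simp add: disjoint_pairs_def)
  have "pairwise disjnt {e \<in> E. mono_pair b e}"
    using assms unfolding disjoint_pairs_def by (blast intro: pairwise_subset[of _ E])
  moreover have "finite e" if "e \<in> E" for e
    using two[OF that] by (simp add: card_ge_0_finite)
  ultimately have "card (\<Union>{e \<in> E. mono_pair b e}) = sum card {e \<in> E. mono_pair b e}"
    by (intro card_Union_disjoint) auto
  then show ?thesis
    using two by simp
qed

lemma card_ends_col_le:
  assumes dp: "disjoint_pairs E" and fin: "finite E"
  shows "card {x \<in> \<Union>E. col b x} \<le>
    card {e \<in> E. neutral_pair e} + 2 * card {e \<in> E. mono_pair b e}"
proof -
  have two: "card e = 2" if "e \<in> E" for e
    using dp that by (simp add: disjoint_pairs_def)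
  have le: "card {x \<in> e. col b x} \<le> of_bool (neutral_pair e) + 2 * of_bool (mono_pair b e)"
    if "e \<in> E" for e
  proof -
    have "card e = 2"
      using two[OF that] .
    then obtain u v where e: "e = {u, v}" "u \<noteq> v"
      by (auto simp: card_2_iff)
    have "{x \<in> e. col b x} = (if col b u then {u} else {}) \<union> (if col b v then {v} else {})"
      by (auto simp: e)
    then show ?thesis
      using e by (auto simp: mono_pair_doubleton neutral_pair_doubleton[of _ _ b])
  qed
  have "{x \<in> \<Union>E. col b x} = (\<Union>e\<in>E. {x \<in> e. col b x})"
    by auto
  then have "card {x \<in> \<Union>E. col b x} \<le> (\<Sum>e\<in>E. card {x \<in> e. col b x})"
    using card_UN_le[OF fin] by simp
  also have "\<dots> \<le> (\<Sum>e\<in>E. of_bool (neutral_pair e) + 2 * of_bool (mono_pair b e))"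
    by (intro sum_mono le)
  also have "\<dots> = card {e \<in> E. neutral_pair e} + 2 * card {e \<in> E. mono_pair b e}"
    using fin by (simp add: sum.distrib sum_distrib_left[symmetric] of_bool_def sum.If_cases Int_def)
  finally show ?thesis .
qed

lemma exchangeable_pair_exists:
  assumes adm: "admissible_ends n F N P E" and F: "F \<subseteq> cube n"
    and ex: "excess b F = int C" and "C < P" and "k \<le> n"
    and bound: "real k * real (P - C) + 1 - real ((P - C + 1) choose 2)
           > real (card F + C) / 2 + real N + real P"
  obtains a c d where "{a, d} \<in> E" "col b a" "col b d" "\<not> col b c"
    "c \<in> cube n - F - \<Union>E" "cube_adj a c"
proof -
  note E = adm[unfolded admissible_ends_iff[of n F N P E b]]
  have fin: "finite E" "finite F" "finite (\<Union>E)"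
    using E F by (meson finite_Diff finite_UnionD finite_cube finite_subset)+
  define S where "S = \<Union>{e \<in> E. mono_pair b e}"
  have card_S: "card S = P - C"
    using card_Union_mono_pairs[of E b] E ex unfolding S_def by linarith
  have S_sub: "S \<subseteq> cube n"
    using E by (auto simp: S_def)
  have S_col: "col b x" if "x \<in> S" for x
    using that by (auto simp: S_def mono_pair_def)
  define B where "B = {x \<in> F. col (\<not> b) x} \<union> {x \<in> \<Union>E. col (\<not> b) x}"
  have "B \<subseteq> F \<union> \<Union>E"
    unfolding B_def by blast
  then have "finite B"
    using fin by (meson finite_UnI finite_subset)
  have "card B \<le> card {x \<in> F. col (\<not> b) x} + card {x \<in> \<Union>E. col (\<not> b) x}"
    unfolding B_def by (rule card_Un_le)
  moreover have "2 * card {x \<in> F. col (\<not> b) x} + C = card F"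
    using card_eq_sum_col[OF fin(2), of b] ex by (simp add: excess_def)
  moreover have "card {x \<in> \<Union>E. col (\<not> b) x} \<le> N + (P + C)"
    using card_ends_col_le[of E "\<not> b"] E fin ex by simp
  ultimately have card_B: "2 * card B \<le> card F + C + 2 * N + 2 * P"
    by linarith
  have "S \<noteq> {}"
    using card_S \<open>C < P\<close> by auto
  then have "n * (P - C) + 1 \<le> card (neighbours {..<n} S) + ((P - C + 1) choose 2)"
    using card_neighbours_ge[OF _ S_sub, of "{..<n}"] card_S by simp
  moreover have "k * (P - C) \<le> n * (P - C)"
    using \<open>k \<le> n\<close> by simp
  ultimately have "k * (P - C) + 1 \<le> card (neighbours {..<n} S) + ((P - C + 1) choose 2)"
    by linarith
  then have "real (k * (P - C) + 1) \<le> real (card (neighbours {..<n} S) + ((P - C + 1) choose 2))"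
    by (rule of_nat_mono)
  moreover have "real (2 * card B) \<le> real (card F + C + 2 * N + 2 * P)"
    using card_B by (rule of_nat_mono)
  ultimately have "real (card B) < real (card (neighbours {..<n} S))"
    using bound unfolding of_nat_add of_nat_mult of_nat_numeral of_nat_1 by argo
  then have "\<not> neighbours {..<n} S \<subseteq> B"
    using card_mono[of B "neighbours {..<n} S"] \<open>finite B\<close> by auto
  then obtain i a where ia: "i < n" "a \<in> S" "flip i a \<notin> B"
    by (auto simp: neighbours_def)
  then have len: "length a = n" and "col b a"
    using S_sub S_col by (auto simp: cube_def)
  obtain e where e: "e \<in> E" "mono_pair b e" "a \<in> e"
    using ia by (auto simp: S_def)
  then obtain d where d: "e = {a, d}" "col b d"
    by (auto simp: mono_pair_def)
  show thesis
  proof (rule that[of a d "flip i a"])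
    show "flip i a \<in> cube n - F - \<Union>E"
      using ia len \<open>col b a\<close> by (auto simp: B_def cube_def col_flip)
  qed (use e d ia len \<open>col b a\<close> in \<open>auto simp: col_flip cube_adj_flip\<close>)
qed

section \<open>The reduction\<close>

theorem lemma5p4:
  fixes M C N P k :: nat
  assumes "even C \<longleftrightarrow> even P" and "even P \<longleftrightarrow> even M"
    and "C \<le> M" and "P > C" and "k > 0"
    and "real k * real (P - C) + 1 - real ((P - C + 1) choose 2)
           > real (M + C) / 2 + real N + real P"
    and "k \<in> \<A> (M + 1) (C + 1) (N + 1) (P - 1)"
  shows "k \<in> \<A> M C N P"
proof -
  have "M + 1 + (C + 1) + 2 * (N + 1) + 2 * (P - 1) = M + C + 2 * N + 2 * P + 2"
    using \<open>P > C\<close> by simp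
  then have log: "real k \<ge> log 2 (real (M + C + 2 * N + 2 * P + 2))"
    using assms(7) by (simp add: \<A>_def)
  then have "real (M + C + 2 * N + 2 * P + 2) \<le> 2 powr real k"
    by (subst (asm) log_le_iff) auto
  then have "real (M + C + 2 * N + 2 * P + 2) \<le> real (2 ^ k)"
    by (simp add: powr_realpow)
  then have pow: "M + C < 2 ^ k"
    unfolding of_nat_le_iff by simp
  have reduced: "freely_prescribable n F (N + 1) (P - 1)"
    if "k \<le> n" "F \<subseteq> cube n" "card F = M + 1" "charge F = C + 1" for n F
    using assms(7) that by (simp add: \<A>_def fault_def mass_def)
  have "freely_prescribable n F N P"
    if n: "k \<le> n" and F: "F \<subseteq> cube n" and card_F: "card F = M" and ch: "charge F = C" for n F
  proof -
    obtain b where b: "excess b F = int C"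
      using charge_eq_imp_excess[OF ch] .
    have fin: "finite F"
      using F finite_cube finite_subset by blast
    have reduced_a: "freely_prescribable n (insert a F) (N + 1) (P - 1)"
      if "a \<in> cube n - F" "col b a" for a
    proof (rule reduced[OF n])
      show "charge (insert a F) = C + 1"
        using excess_insert[of F a b] that fin b by (intro excess_imp_charge[of b]) simp
    qed (use that F fin card_F in auto)
    show ?thesis
      unfolding freely_prescribable_def
    proof (intro conjI allI impI)
      have "card F + C < 2 ^ n"
        using pow card_F power_increasing[OF n, of "2::nat"] by linarith
      then obtain a where a: "a \<in> cube n - F" "col b a"
        using free_vertex_exists[OF F b] n \<open>k > 0\<close> by auto
      then obtain E where E: "admissible_ends n (insert a F) (N + 1) (P - 1) E"
        using reduced_a unfolding freely_prescribable_def by blast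
      then have "card {e \<in> E. neutral_pair e} \<noteq> 0"
        by (simp add: admissible_ends_def)
      then have "{e \<in> E. neutral_pair e} \<noteq> {}"
        by (metis card.empty)
      then obtain u v where "{u, v} \<in> E" "red u" "green v"
        unfolding neutral_pair_def by blast
      then obtain c d where "{c, d} \<in> E" "\<not> col b c" "col b d"
        unfolding red_def green_def col_def by (metis insert_commute)
      then show "\<exists>E. admissible_ends n F N P E"
        using admissible_ends_exchange_back[OF E _ a(2) _ _ a(1) F] \<open>P > C\<close> by auto
    next
      fix E assume adm: "admissible_ends n F N P E"
      obtain a c d where ad: "{a, d} \<in> E" and col: "col b a" "col b d" "\<not> col b c"
        and c: "c \<in> cube n - F - \<Union>E" and adj: "cube_adj a c"
        using exchangeable_pair_exists[OF adm F b \<open>P > C\<close> n assms(6)[folded card_F]] .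
      let ?E' = "insert {c, d} (E - {{a, d}})"
      have a: "a \<in> cube n - F"
        using adm ad by (auto simp: admissible_ends_def in_balance_def)
      have "admissible_ends n (insert a F) (N + 1) (P - 1) ?E'"
        by (rule admissible_ends_exchange[OF adm ad col c F])
      then obtain \<P> where cov: "path_covering (cube n - insert a F) cube_adj \<P>"
        and ends: "path_ends ` \<P> = ?E'"
        using reduced_a[OF a col(1)] unfolding freely_prescribable_def by blast
      have "cube n - insert a F = cube n - F - {a}"
        by auto
      then obtain \<Q> where "path_covering (cube n - F) cube_adj \<Q>"
        and "path_ends ` \<Q> = insert {a, d} (path_ends ` \<P> - {{c, d}})"
        using path_covering_extend[of "cube n - F" a cube_adj \<P> c d] cov ends a adj
        by (auto simp: cube_adj_commute)
      moreover have "insert {a, d} (?E' - {{c, d}}) = E"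
        using ad c by auto
      ultimately show "\<exists>\<P>. path_covering (cube n - F) cube_adj \<P> \<and> path_ends ` \<P> = E"
        using ends by auto
    qed
  qed
  moreover have "real k \<ge> log 2 (real (M + C + 2 * N + 2 * P))"
  proof -
    have "log 2 (real (M + C + 2 * N + 2 * P)) \<le> log 2 (real (M + C + 2 * N + 2 * P + 2))"
      using \<open>P > C\<close> by (subst log_le_cancel_iff) auto
    then show ?thesis
      using log by simp
  qed
  ultimately show ?thesis
    by (simp add: \<A>_def fault_def mass_def)
qed

end
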